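(* Let $n$ be a positive integer and $k$ an integer with $0 \leq k < n$. Then the Full-Flag Johnson graph $FJ(n,k)$ is the Cayley graph on the symmetric group $S_n$ generated by (that is, with connection set) the set of all $n \times n$ $(n-k)$-block diagonal permutation matrices.
   Context: Vertices are permutations $u=(u_1,\ldots,u_n)$ of $(1,2,\ldots,n)$, identified with elements of $S_n$ via $u: i \mapsto u_i$. For $i \in [n]=\{1,\ldots,n\}$ write $u(i) = \{u_1, u_2, \ldots, u_i\}$. For integers $0 \leq k < n$, the Full-Flag Johnson graph $FJ(n,k)$ has as vertex set all permutations of $(1,\ldots,n)$; two vertices $u,v$ (possibly equal) are adjacent if and only if $u(i) \neq v(i)$ for exactly $k$ integers $i \in [n]$. (Thus for $k=0$ every vertex is adjacent to itself; for $k>0$ there are no loops.) A permutation matrix is reducible if it can be decomposed into (two or more) non-empty square submatrices along its main diagonal that are themselves permutation matrices, all entries outside these diagonal blocks being $0$; otherwise it is irreducible. For a positive integer $N$, a permutation matrix is $N$-block diagonal if it can be decomposed into exactly $N$ irreducible permutation matrices as consecutive blocks along its main diagonal. An $n\times n$ permutation matrix is identified with the corresponding element of $S_n$. For a subset $T \subseteq S_n$ closed under inverses, the Cayley graph on $S_n$ generated by $T$ has vertex set $S_n$, with $u$ adjacent to $v$ if and only if $v = u \circ \sigma$ for some $\sigma \in T$ (so $\sigma$ acts by rearranging positions: $v_i = u_{\sigma(i)}$). $T$ is just the connection set: it is allowed to contain the identity (giving loops) and is not required to generate $S_n$ as a group. *)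

theory Defs
  imports
    "HOL-Algebra.Sym_Groups"
    "Jordan_Normal_Form.Matrix"
    "Graph_Theory.Pair_Digraph"
begin

(* An undirected graph, possibly with loops, is represented as a pair_pre_digraph whose arc
   relation is the adjacency relation.  In FJ, k = 0 makes every vertex adjacent to itself.
   The permutation u stands for the tuple (u 1, ..., u n), so u(i) in the usual notation for
   the i-th member of the flag is the image of {1..i} under u. *)
definition full_flag_johnson :: "nat \<Rightarrow> nat \<Rightarrow> (nat \<Rightarrow> nat) pair_pre_digraph" where
  "full_flag_johnson n k =
    \<lparr> pverts = {u. u permutes {1..n}},
      parcs = {(u, v). u permutes {1..n} \<and> v permutes {1..n} \<and>
                 card {i \<in> {1..n}. u ` {1..i} \<noteq> v ` {1..i}} = k} \<rparr>"

(* The connection set may contain the unit and need not generate the group. *)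
definition connection_set :: "('a, 'b) monoid_scheme \<Rightarrow> 'a set \<Rightarrow> bool" where
  "connection_set G T \<longleftrightarrow> T \<subseteq> carrier G \<and> (\<forall>t\<in>T. inv\<^bsub>G\<^esub> t \<in> T)"

definition cayley_graph :: "('a, 'b) monoid_scheme \<Rightarrow> 'a set \<Rightarrow> 'a pair_pre_digraph" where
  "cayley_graph G T =
    \<lparr> pverts = carrier G,
      parcs = {(u, v). u \<in> carrier G \<and> v \<in> carrier G \<and> (\<exists>t\<in>T. v = u \<otimes>\<^bsub>G\<^esub> t)} \<rparr>"

definition permutation_mat :: "int mat \<Rightarrow> bool" where
  "permutation_mat A \<longleftrightarrow> square_mat A \<and> elements_mat A \<subseteq> {0, 1} \<and>
     (\<forall>i<dim_row A. \<exists>!j. j < dim_col A \<and> A $$ (i, j) = 1) \<and>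
     (\<forall>j<dim_col A. \<exists>!i. i < dim_row A \<and> A $$ (i, j) = 1)"

(* The condition on dim_row excludes empty blocks, which diag_block_mat would accept. *)
definition perm_block_decomposition :: "int mat list \<Rightarrow> int mat \<Rightarrow> bool" where
  "perm_block_decomposition Bs A \<longleftrightarrow>
     A = diag_block_mat Bs \<and> (\<forall>B\<in>set Bs. permutation_mat B \<and> 0 < dim_row B)"

definition reducible_mat :: "int mat \<Rightarrow> bool" where
  "reducible_mat A \<longleftrightarrow> (\<exists>Bs. 2 \<le> length Bs \<and> perm_block_decomposition Bs A)"

definition irreducible_mat :: "int mat \<Rightarrow> bool" where
  "irreducible_mat A \<longleftrightarrow> permutation_mat A \<and> \<not> reducible_mat A"

definition block_diagonal_mat :: "nat \<Rightarrow> int mat \<Rightarrow> bool" where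
  "block_diagonal_mat N A \<longleftrightarrow>
     (\<exists>Bs. length Bs = N \<and> perm_block_decomposition Bs A \<and> (\<forall>B\<in>set Bs. irreducible_mat B))"

(* Points are numbered from 1 and matrix indices from 0.  Column j+1 has its entry 1 in
   row s(j+1), so the matrix maps the basis vector e_j to e_(s j). *)
definition mat_of_perm :: "nat \<Rightarrow> (nat \<Rightarrow> nat) \<Rightarrow> int mat" where
  "mat_of_perm n s = mat n n (\<lambda>(i, j). if s (j + 1) = i + 1 then 1 else 0)"

lemma bij_betw_mat_of_perm:
  "bij_betw (mat_of_perm n) {s. s permutes {1..n}} {A \<in> carrier_mat n n. permutation_mat A}"
proof (rule bij_betw_imageI)
  show "inj_on (mat_of_perm n) {s. s permutes {1..n}}"
  proof (rule inj_onI)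
    fix s t assume "s \<in> {s. s permutes {1..n}}" "t \<in> {s. s permutes {1..n}}"
      and eq: "mat_of_perm n s = mat_of_perm n t"
    then have s: "s permutes {1..n}" and t: "t permutes {1..n}" by auto
    show "s = t"
    proof
      fix x
      show "s x = t x"
      proof (cases "x \<in> {1..n}")
        case True
        then have sx: "s x \<in> {1..n}" using permutes_in_image[OF s] by blast
        have entry: "mat_of_perm n p $$ (s x - 1, x - 1) = (if p x = s x then 1 else 0)" for p
        proof -
          have "s x - 1 < n" "x - 1 < n" "s x - 1 + 1 = s x" "x - 1 + 1 = x"
            using True sx by auto
          then show ?thesis by (simp only: mat_of_perm_def index_mat prod.case)
        qed
        have "mat_of_perm n t $$ (s x - 1, x - 1) = 1" using entry[of s] by (simp add: eq)
        then show ?thesis using entry[of t] by (simp split: if_splits)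
      next
        case False
        then show ?thesis using s t by (simp add: permutes_not_in)
      qed
    qed
  qed
  show "mat_of_perm n ` {s. s permutes {1..n}} = {A \<in> carrier_mat n n. permutation_mat A}"
  proof (intro subset_antisym subsetI)
    fix A assume "A \<in> mat_of_perm n ` {s. s permutes {1..n}}"
    then obtain s where s: "s permutes {1..n}" and A: "A = mat_of_perm n s" by blast
    have dims: "dim_row A = n" "dim_col A = n" by (simp_all add: A mat_of_perm_def)
    have entry: "A $$ (i, j) = (if s (j + 1) = i + 1 then 1 else 0)" if "i < n" "j < n" for i j
      using that by (simp add: A mat_of_perm_def)
    have row: "\<exists>!j. j < n \<and> A $$ (i, j) = 1" if i: "i < n" for i
    proof -
      obtain x where x: "s x = i + 1" using permutes_surj[OF s] by (metis surjD)
      have "x \<in> {1..n}" using x i permutes_in_image[OF s, of x] by simp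
      then have "x - 1 < n \<and> A $$ (i, x - 1) = 1" using x i by (auto simp: entry)
      moreover have "j = x - 1" if "j < n \<and> A $$ (i, j) = 1" for j
      proof -
        have "s (j + 1) = s x" using that x i entry[of i j] by (auto split: if_splits)
        then have "j + 1 = x" using permutes_inj[OF s] by (blast dest: injD)
        then show ?thesis by simp
      qed
      ultimately show ?thesis by blast
    qed
    have col: "\<exists>!i. i < n \<and> A $$ (i, j) = 1" if j: "j < n" for j
    proof -
      have "s (j + 1) \<in> {1..n}" using j permutes_in_image[OF s, of "j + 1"] by simp
      then have "s (j + 1) - 1 < n \<and> A $$ (s (j + 1) - 1, j) = 1" using j by (auto simp: entry)
      moreover have "i = s (j + 1) - 1" if "i < n \<and> A $$ (i, j) = 1" for i
        using that j entry[of i j] by (auto split: if_splits)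
      ultimately show ?thesis by blast
    qed
    have elems: "elements_mat A \<subseteq> {0, 1}"
    proof
      fix a assume "a \<in> elements_mat A"
      then obtain i j where "i < n" "j < n" "a = A $$ (i, j)"
        by (auto simp: dims)
      then show "a \<in> {0, 1}" by (simp add: entry)
    qed
    have "permutation_mat A"
      unfolding permutation_mat_def square_mat.simps dims
      by (intro conjI allI impI) (rule refl, rule elems, erule row, erule col)
    moreover have "A \<in> carrier_mat n n" using dims by (rule carrier_matI)
    ultimately show "A \<in> {A \<in> carrier_mat n n. permutation_mat A}" by blast
  next
    fix A assume "A \<in> {A \<in> carrier_mat n n. permutation_mat A}"
    then have A: "permutation_mat A" and carr: "A \<in> carrier_mat n n" by blast+
    note dims = carrier_matD[OF carr]
    note A' = A[unfolded permutation_mat_def dims]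
    have row: "\<exists>!j. j < n \<and> A $$ (i, j) = 1" if "i < n" for i
      using A'[THEN conjunct2, THEN conjunct2, THEN conjunct1, rule_format, OF that] .
    have col: "\<exists>!i. i < n \<and> A $$ (i, j) = 1" if "j < n" for j
      using A'[THEN conjunct2, THEN conjunct2, THEN conjunct2, rule_format, OF that] .
    have elems: "elements_mat A \<subseteq> {0, 1}"
      using A'[THEN conjunct2, THEN conjunct1] .
    have ent: "A $$ (i, j) = 0 \<or> A $$ (i, j) = 1" if "i < n" "j < n" for i j
    proof -
      have "A $$ (i, j) \<in> elements_mat A"
        by (rule elements_matI[OF carr that refl])
      then show ?thesis using elems by blast
    qed
    define c where "c j = (THE i. i < n \<and> A $$ (i, j) = 1)" for j
    have c: "c j < n \<and> A $$ (c j, j) = 1" if "j < n" for j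
      unfolding c_def by (rule theI'[OF col[OF that]])
    define s where "s x = (if x \<in> {1..n} then c (x - 1) + 1 else x)" for x
    have "inj_on s {1..n}"
    proof (rule inj_onI)
      fix x y assume x: "x \<in> {1..n}" and y: "y \<in> {1..n}" and "s x = s y"
      then have "c (x - 1) = c (y - 1)" by (simp add: s_def)
      moreover have "x - 1 < n" "y - 1 < n" using x y by auto
      ultimately have "x - 1 = y - 1"
        using c[of "x - 1"] c[of "y - 1"] row[of "c (x - 1)"] by auto
      then show "x = y" using x y by auto
    qed
    moreover have "s ` {1..n} \<subseteq> {1..n}"
    proof
      fix y assume "y \<in> s ` {1..n}"
      then obtain x where x: "x \<in> {1..n}" and y: "y = c (x - 1) + 1" by (auto simp: s_def)
      have "x - 1 < n" using x by auto
      then show "y \<in> {1..n}" using c[of "x - 1"] y by simp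
    qed
    ultimately have "bij_betw s {1..n} {1..n}"
      by (simp add: bij_betw_def endo_inj_surj)
    then have perm: "s permutes {1..n}" by (rule bij_imp_permutes) (auto simp: s_def)
    have "A = mat_of_perm n s"
    proof (rule eq_matI)
      fix i j assume "i < dim_row (mat_of_perm n s)" "j < dim_col (mat_of_perm n s)"
      then have i: "i < n" and j: "j < n" by (simp_all add: mat_of_perm_def)
      have "A $$ (i, j) = 1 \<longleftrightarrow> i = c j" using c[OF j] col[OF j] i by (metis (no_types))
      moreover have "mat_of_perm n s $$ (i, j) = (if c j = i then 1 else 0)"
        using i j by (simp add: mat_of_perm_def s_def)
      ultimately show "A $$ (i, j) = mat_of_perm n s $$ (i, j)" using ent[OF i j] by auto
    qed (simp_all add: dims mat_of_perm_def)
    then show "A \<in> mat_of_perm n ` {s. s permutes {1..n}}" using perm by blast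
  qed
qed

definition block_diagonal_perms :: "nat \<Rightarrow> nat \<Rightarrow> (nat \<Rightarrow> nat) set" where
  "block_diagonal_perms n N = {s. s permutes {1..n} \<and> block_diagonal_mat N (mat_of_perm n s)}"

end

(* For a permutation s of {1..n}, the positions i with s ` {1..i} = {1..i} are exactly the places
   after which the matrix of s can be cut into diagonal blocks, where i = n counts as a cut.
   Cuts are additive over block sums, and a nonempty permutation matrix is irreducible iff it has
   no cut besides the final one; hence the number of irreducible blocks is the number of cuts.
   For arcs, u ` {1..i} = v ` {1..i} says that u^-1 v has a cut at i. *)
theory Submission
  imports Defs
begin

section \<open>Cuts of a matrix\<close>

definition cuts :: "'a::zero mat \<Rightarrow> nat set" where
  "cuts A = {i \<in> {1..dim_row A}.
     \<forall>r<dim_row A. \<forall>c<dim_col A. A $$ (r, c) \<noteq> 0 \<longrightarrow> (r < i \<longleftrightarrow> c < i)}"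

abbreviation block_sum :: "'a::zero mat \<Rightarrow> 'a mat \<Rightarrow> 'a mat" where
  "block_sum A B \<equiv>
     four_block_mat A (0\<^sub>m (dim_row A) (dim_col B)) (0\<^sub>m (dim_row B) (dim_col A)) B"

lemma diag_block_mat_pair: "diag_block_mat [A, B] = block_sum A B"
  \<comment> \<open>Only the outer list cell is unfolded; unfolding \<open>[B]\<close> too would
    leave a block sum with the empty matrix.\<close>
  by (simp only: diag_block_mat.simps(2)[of A "[B]"] diag_block_mat_singleton Let_def)

lemma finite_cuts [simp]: "finite (cuts A)"
  by (simp add: cuts_def)

lemma cuts_le_dim_row: "i \<in> cuts A \<Longrightarrow> i \<le> dim_row A"
  by (simp add: cuts_def)

lemma dim_row_in_cuts:
  assumes "square_mat A" and "0 < dim_row A"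
  shows "dim_row A \<in> cuts A"
  using assms by (simp add: cuts_def)

text \<open>The nonzero entries that \<open>B\<close> adds have both indices at least
  \<open>dim_row A\<close>, because \<open>A\<close> is square. For i up to that bound they satisfy
  the cut condition automatically.\<close>

lemma cuts_block_sum_low:
  assumes "square_mat A" and "i \<le> dim_row A"
  shows "i \<in> cuts (block_sum A B) \<longleftrightarrow> i \<in> cuts A"
proof
  assume i: "i \<in> cuts (block_sum A B)"
  show "i \<in> cuts A"
    unfolding cuts_def
  proof (intro CollectI conjI allI impI)
    show "i \<in> {1..dim_row A}" using i assms by (simp add: cuts_def)
    fix r c assume rc: "r < dim_row A" "c < dim_col A" "A $$ (r, c) \<noteq> 0"
    then have "block_sum A B $$ (r, c) \<noteq> 0" by simp
    moreover have "r < dim_row (block_sum A B)" "c < dim_col (block_sum A B)" using rc by simp_all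
    ultimately show "(r < i) = (c < i)" using i unfolding cuts_def by blast
  qed
next
  assume i: "i \<in> cuts A"
  show "i \<in> cuts (block_sum A B)"
    unfolding cuts_def
  proof (intro CollectI conjI allI impI)
    show "i \<in> {1..dim_row (block_sum A B)}" using i by (simp add: cuts_def)
    fix r c assume "r < dim_row (block_sum A B)" "c < dim_col (block_sum A B)"
      "block_sum A B $$ (r, c) \<noteq> 0"
    then show "(r < i) = (c < i)"
      using i assms by (auto simp: cuts_def split: if_splits)
  qed
qed

text \<open>Nonzero entries of \<open>A\<close> have both indices below \<open>dim_row A\<close>, so
  only those of \<open>B\<close> matter, shifted by \<open>dim_row A\<close>. The case j = 0 is
  different: the end of a nonempty \<open>A\<close> is a cut of the sum, while 0 is never a cut of
  \<open>B\<close>.\<close>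

lemma cuts_block_sum_high:
  assumes "square_mat A" and "0 < j"
  shows "dim_row A + j \<in> cuts (block_sum A B) \<longleftrightarrow> j \<in> cuts B"
proof
  assume i: "dim_row A + j \<in> cuts (block_sum A B)"
  show "j \<in> cuts B"
    unfolding cuts_def
  proof (intro CollectI conjI allI impI)
    show "j \<in> {1..dim_row B}" using i assms by (simp add: cuts_def)
    fix r c assume rc: "r < dim_row B" "c < dim_col B" "B $$ (r, c) \<noteq> 0"
    let ?r = "dim_row A + r" and ?c = "dim_row A + c"
    have "block_sum A B $$ (?r, ?c) \<noteq> 0" using rc assms by simp
    moreover have "?r < dim_row (block_sum A B)" "?c < dim_col (block_sum A B)"
      using rc assms by simp_all
    ultimately have "(?r < dim_row A + j) = (?c < dim_row A + j)"
      using i unfolding cuts_def by blast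
    then show "(r < j) = (c < j)" by simp
  qed
next
  assume j: "j \<in> cuts B"
  show "dim_row A + j \<in> cuts (block_sum A B)"
    unfolding cuts_def
  proof (intro CollectI conjI allI impI)
    show "dim_row A + j \<in> {1..dim_row (block_sum A B)}" using j by (simp add: cuts_def)
    fix r c assume rc: "r < dim_row (block_sum A B)" "c < dim_col (block_sum A B)"
      "block_sum A B $$ (r, c) \<noteq> 0"
    show "(r < dim_row A + j) = (c < dim_row A + j)"
    proof (cases "r < dim_row A")
      case True
      then show ?thesis using rc assms by (auto split: if_splits)
    next
      case False
      then have "dim_row A \<le> c" "B $$ (r - dim_row A, c - dim_row A) \<noteq> 0"
        using rc assms by (auto split: if_splits)
      moreover have "r - dim_row A < dim_row B" "c - dim_row A < dim_col B"
        using rc False \<open>dim_row A \<le> c\<close> assms by auto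
      ultimately have "(r - dim_row A < j) = (c - dim_row A < j)"
        using j unfolding cuts_def by blast
      then show ?thesis using False \<open>dim_row A \<le> c\<close> by auto
    qed
  qed
qed

text \<open>The cuts up to \<open>dim_row A\<close> come from \<open>A\<close> and those beyond it
  from \<open>B\<close>. The seam behind a nonempty \<open>A\<close> is counted once, as the final
  cut of \<open>A\<close>.\<close>

lemma card_cuts_block_sum:
  assumes "square_mat A"
  shows "card (cuts (block_sum A B)) = card (cuts A) + card (cuts B)"
proof -
  have pos: "j \<in> cuts B \<Longrightarrow> 0 < j" for j by (simp add: cuts_def)
  have "cuts (block_sum A B) = cuts A \<union> (+) (dim_row A) ` cuts B"
  proof (rule Set.set_eqI)
    fix i
    show "i \<in> cuts (block_sum A B) \<longleftrightarrow> i \<in> cuts A \<union> (+) (dim_row A) ` cuts B"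
    proof (cases "i \<le> dim_row A")
      case True
      then have "i \<notin> (+) (dim_row A) ` cuts B" using pos by fastforce
      then show ?thesis using cuts_block_sum_low[OF assms True] by blast
    next
      case False
      then obtain j where j: "i = dim_row A + j" "0 < j"
        by (metis less_imp_add_positive not_le)
      have "i \<notin> cuts A" using False by (simp add: cuts_def)
      moreover have "i \<in> (+) (dim_row A) ` cuts B \<longleftrightarrow> j \<in> cuts B"
        by (auto simp: j(1))
      ultimately show ?thesis
        unfolding j(1) cuts_block_sum_high[OF assms j(2)] by blast
    qed
  qed
  moreover have "cuts A \<inter> (+) (dim_row A) ` cuts B = {}"
    using pos by (fastforce simp: cuts_def)
  ultimately show ?thesis by (simp add: card_Un_disjoint card_image)
qed

lemma card_cuts_diag_block_mat:
  assumes "\<forall>B\<in>set Bs. square_mat B"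
  shows "card (cuts (diag_block_mat Bs)) = (\<Sum>B\<leftarrow>Bs. card (cuts B))"
  using assms
proof (induction Bs)
  case Nil
  then show ?case by (simp add: cuts_def)
next
  case (Cons B Bs)
  then show ?case
    using card_cuts_block_sum[of B "diag_block_mat Bs"] by (simp add: Let_def)
qed

section \<open>Permutation matrices\<close>

lemma permutation_mat_square: "permutation_mat A \<Longrightarrow> square_mat A"
  by (simp add: permutation_mat_def)

text \<open>By \<open>block\<close>, no nonzero entry shares just one of its indices with the window
  {a..<b}. So the 1 of each row and column of the window lies inside the window, and its uniqueness
  is inherited from \<open>A\<close>. The windows {0..<i} and {i..<n} give the two halves at a cut
  i.\<close>

lemma permutation_mat_diagonal_submatrix:
  assumes A: "permutation_mat A" and b: "b \<le> dim_row A"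
    and block: "\<And>r c. r < dim_row A \<Longrightarrow> c < dim_row A \<Longrightarrow> A $$ (r, c) \<noteq> 0 \<Longrightarrow>
      r \<in> {a..<b} \<longleftrightarrow> c \<in> {a..<b}"
  shows "permutation_mat (mat (b - a) (b - a) (\<lambda>(r, c). A $$ (r + a, c + a)))"
    (is "permutation_mat ?M")
proof -
  have dim: "dim_col A = dim_row A" using permutation_mat_square[OF A] by simp
  have carr: "A \<in> carrier_mat (dim_row A) (dim_row A)" by (rule carrier_matI) (simp_all add: dim)
  have elems: "elements_mat A \<subseteq> {0, 1}" using A by (simp add: permutation_mat_def)
  have rows: "\<forall>i<dim_row A. \<exists>!j. j < dim_row A \<and> A $$ (i, j) = 1"
    using A unfolding permutation_mat_def dim by (elim conjE)
  have cols: "\<forall>j<dim_row A. \<exists>!i. i < dim_row A \<and> A $$ (i, j) = 1"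
    using A unfolding permutation_mat_def dim by (elim conjE)
  note row = rows[rule_format] and col = cols[rule_format]
  have one: "r \<in> {a..<b} \<longleftrightarrow> c \<in> {a..<b}"
    if "r < dim_row A" "c < dim_row A" "A $$ (r, c) = 1" for r c
    using block[of r c] that by simp
  show ?thesis
    unfolding permutation_mat_def
  proof (intro conjI allI impI subsetI)
    show "square_mat ?M" by simp
    fix x assume "x \<in> elements_mat ?M"
    then obtain r c where "r < b - a" "c < b - a" "x = A $$ (r + a, c + a)"
      by (auto dest!: elements_matD)
    then have "x \<in> elements_mat A"
      using elements_matI[OF carr, of "r + a" "c + a" x] b by simp
    then show "x \<in> {0, 1}" using elems by blast
  next
    fix i assume "i < dim_row ?M"
    then have i: "i < b - a" "i + a < b" "i + a < dim_row A" using b by auto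
    have "\<exists>!j. j < dim_row A \<and> A $$ (i + a, j) = 1" by (rule row[OF i(3)])
    then obtain j where j: "j < dim_row A" "A $$ (i + a, j) = 1"
      and uniq: "\<And>j'. j' < dim_row A \<Longrightarrow> A $$ (i + a, j') = 1 \<Longrightarrow> j' = j"
      by (elim ex1E) blast
    have "j \<in> {a..<b}" using one[OF i(3) j] i(2) by simp
    then show "\<exists>!j. j < dim_col ?M \<and> ?M $$ (i, j) = 1"
    proof (intro ex1I[of _ "j - a"])
      show "j - a < dim_col ?M \<and> ?M $$ (i, j - a) = 1"
        using i(1) j \<open>j \<in> {a..<b}\<close> by auto
      fix j' assume j': "j' < dim_col ?M \<and> ?M $$ (i, j') = 1"
      then have "A $$ (i + a, j' + a) = 1" using i(1) by auto
      moreover have "j' + a < dim_row A" using j' b by auto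
      ultimately have "j' + a = j" by (intro uniq)
      then show "j' = j - a" by simp
    qed
  next
    fix j assume "j < dim_col ?M"
    then have j: "j < b - a" "j + a < b" "j + a < dim_row A" using b by auto
    have "\<exists>!i. i < dim_row A \<and> A $$ (i, j + a) = 1" by (rule col[OF j(3)])
    then obtain i where i: "i < dim_row A" "A $$ (i, j + a) = 1"
      and uniq: "\<And>i'. i' < dim_row A \<Longrightarrow> A $$ (i', j + a) = 1 \<Longrightarrow> i' = i"
      by (elim ex1E) blast
    have "i \<in> {a..<b}" using one[OF i(1) j(3) i(2)] j(2) by simp
    then show "\<exists>!i. i < dim_row ?M \<and> ?M $$ (i, j) = 1"
    proof (intro ex1I[of _ "i - a"])
      show "i - a < dim_row ?M \<and> ?M $$ (i - a, j) = 1"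
        using j(1) i \<open>i \<in> {a..<b}\<close> by auto
      fix i' assume i': "i' < dim_row ?M \<and> ?M $$ (i', j) = 1"
      then have "A $$ (i' + a, j + a) = 1" using j(1) by auto
      moreover have "i' + a < dim_row A" using i' b by auto
      ultimately have "i' + a = i" by (intro uniq)
      then show "i' = i - a" by simp
    qed
  qed
qed

text \<open>The cut condition makes both off-diagonal corners vanish. Positive sizes make the parts
  admissible as blocks; the strict upper bounds serve the induction in
  \<open>ex_block_diagonal\<close>.\<close>

lemma permutation_mat_split_at_cut:
  assumes A: "permutation_mat A" and i: "i \<in> cuts A" "i < dim_row A"
  obtains B C where "permutation_mat B" "permutation_mat C" "A = block_sum B C"
    "0 < dim_row B" "dim_row B < dim_row A" "0 < dim_row C" "dim_row C < dim_row A"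
proof
  let ?n = "dim_row A"
  let ?B = "mat i i (\<lambda>(r, c). A $$ (r, c))"
  let ?C = "mat (?n - i) (?n - i) (\<lambda>(r, c). A $$ (r + i, c + i))"
  have dim: "dim_col A = ?n" using permutation_mat_square[OF A] by simp
  have cut: "r < i \<longleftrightarrow> c < i" if "r < ?n" "c < ?n" "A $$ (r, c) \<noteq> 0" for r c
    using i that unfolding cuts_def dim by blast
  show "permutation_mat ?B"
    using permutation_mat_diagonal_submatrix[OF A, of i 0] cut i by auto
  show "permutation_mat ?C"
    using permutation_mat_diagonal_submatrix[OF A, of ?n i] cut i by force
  have off_diagonal: "A $$ (r, c) = 0" if "r < ?n" "c < ?n" "(r < i) \<noteq> (c < i)" for r c
    using cut that by blast
  show "A = block_sum ?B ?C"
    by (rule eq_matI) (use i dim in \<open>auto simp: off_diagonal\<close>)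
  show "0 < dim_row ?B" "dim_row ?B < ?n" "0 < dim_row ?C" "dim_row ?C < ?n"
    using i by (auto simp: cuts_def)
qed

section \<open>Counting irreducible blocks by cuts\<close>

lemma card_cuts_pos:
  assumes "permutation_mat A" and "0 < dim_row A"
  shows "0 < card (cuts A)"
  using dim_row_in_cuts[OF permutation_mat_square[OF assms(1)] assms(2)] card_gt_0_iff by fastforce

text \<open>A cut before the end would split \<open>A\<close> into two blocks. Conversely, in a
  decomposition each nonempty block contributes at least its own end as a cut, so two blocks force
  two cuts.\<close>

lemma irreducible_mat_iff_card_cuts:
  assumes A: "permutation_mat A" and pos: "0 < dim_row A"
  shows "irreducible_mat A \<longleftrightarrow> card (cuts A) = 1"
proof
  assume irr: "irreducible_mat A"
  have "i = dim_row A" if i: "i \<in> cuts A" for i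
  proof (rule ccontr)
    assume "i \<noteq> dim_row A"
    with i have "i < dim_row A" by (simp add: cuts_def)
    from permutation_mat_split_at_cut[OF A i this] obtain B C where
      "permutation_mat B" "permutation_mat C" "A = block_sum B C" "0 < dim_row B" "0 < dim_row C"
      by blast
    then have "perm_block_decomposition [B, C] A"
      by (simp add: perm_block_decomposition_def diag_block_mat_pair del: diag_block_mat.simps)
    then show False using irr unfolding irreducible_mat_def reducible_mat_def by force
  qed
  then have "cuts A = {dim_row A}"
    using dim_row_in_cuts[OF permutation_mat_square[OF A] pos] by blast
  then show "card (cuts A) = 1" by simp
next
  assume card: "card (cuts A) = 1"
  have "\<not> reducible_mat A"
  proof
    assume "reducible_mat A"
    then obtain Bs where len: "2 \<le> length Bs" and AB: "A = diag_block_mat Bs"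
      and Bs: "\<forall>B\<in>set Bs. permutation_mat B \<and> 0 < dim_row B"
      unfolding reducible_mat_def perm_block_decomposition_def by blast
    \<comment> \<open>The length is written as a sum of ones in order to compare it term by term
      with the numbers of cuts.\<close>
    have "length Bs = (\<Sum>B\<leftarrow>Bs. 1)" by (simp add: sum_list_triv)
    also have "\<dots> \<le> (\<Sum>B\<leftarrow>Bs. card (cuts B))"
      by (rule sum_list_mono) (use Bs card_cuts_pos in \<open>simp add: Suc_le_eq\<close>)
    also have "\<dots> = card (cuts A)"
      unfolding AB by (rule card_cuts_diag_block_mat[symmetric])
        (use Bs permutation_mat_square in blast)
    finally show False using len card by simp
  qed
  with A show "irreducible_mat A" by (simp add: irreducible_mat_def)
qed

text \<open>Each irreducible block contributes exactly one cut and cuts are additive. In particular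
  all decompositions of \<open>A\<close> into irreducible blocks have the same length.\<close>

lemma card_cuts_of_block_diagonal:
  assumes "block_diagonal_mat N A"
  shows "card (cuts A) = N"
proof -
  from assms obtain Bs where len: "length Bs = N" and AB: "A = diag_block_mat Bs"
    and Bs: "\<forall>B\<in>set Bs. permutation_mat B \<and> 0 < dim_row B" "\<forall>B\<in>set Bs. irreducible_mat B"
    unfolding block_diagonal_mat_def perm_block_decomposition_def by blast
  have one: "card (cuts B) = 1" if "B \<in> set Bs" for B
    using Bs irreducible_mat_iff_card_cuts that by blast
  have "card (cuts A) = (\<Sum>B\<leftarrow>Bs. card (cuts B))"
    unfolding AB by (rule card_cuts_diag_block_mat) (use Bs permutation_mat_square in blast)
  also have "\<dots> = (\<Sum>B\<leftarrow>Bs. 1)"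
    by (simp add: one cong: map_cong)
  finally show ?thesis using len by (simp add: sum_list_triv)
qed

text \<open>Splitting at cuts before the end is repeated until none is left; strong induction on the
  size makes this terminate. The number of blocks may stay existential, since
  \<open>card_cuts_of_block_diagonal\<close> recovers it.\<close>

lemma ex_block_diagonal:
  assumes "permutation_mat A"
  shows "\<exists>N. block_diagonal_mat N A"
  using assms
proof (induction "dim_row A" arbitrary: A rule: less_induct)
  case less
  note A = less.prems
  consider "dim_row A = 0" | "0 < dim_row A" "card (cuts A) = 1"
    | i where "i \<in> cuts A" "i < dim_row A"
  proof (cases "\<exists>i\<in>cuts A. i < dim_row A")
    case False
    then have "cuts A \<subseteq> {dim_row A}"
      using cuts_le_dim_row le_neq_implies_less by blast
    then have "cuts A = {dim_row A}" if "0 < dim_row A"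
      using dim_row_in_cuts[OF permutation_mat_square[OF A] that] by blast
    then show thesis using that(1,2) by (metis card_1_singleton_iff neq0_conv One_nat_def)
  qed (use that in blast)
  then show ?case
  proof cases
    case 1
    \<comment> \<open>The empty matrix is the sum of no blocks, in agreement with its having no
      cuts.\<close>
    then have "A = diag_block_mat []"
      using permutation_mat_square[OF A] by (intro eq_matI) auto
    then have "block_diagonal_mat 0 A"
      by (simp add: block_diagonal_mat_def perm_block_decomposition_def)
    then show ?thesis ..
  next
    case 2
    then have "perm_block_decomposition [A] A" "irreducible_mat A"
      using A by (simp_all add: irreducible_mat_iff_card_cuts perm_block_decomposition_def
          del: diag_block_mat.simps)
    then have "block_diagonal_mat 1 A"
      unfolding block_diagonal_mat_def by (intro exI[of _ "[A]"]) simp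
    then show ?thesis ..
  next
    case 3
    from permutation_mat_split_at_cut[OF A 3] obtain B C where
      BC: "permutation_mat B" "permutation_mat C" "A = block_sum B C"
        "dim_row B < dim_row A" "dim_row C < dim_row A" by blast
    from less.hyps BC obtain M N where "block_diagonal_mat M B" "block_diagonal_mat N C" by blast
    then obtain Bs Cs where
      "perm_block_decomposition Bs B" "\<forall>X\<in>set Bs. irreducible_mat X"
      "perm_block_decomposition Cs C" "\<forall>X\<in>set Cs. irreducible_mat X"
      unfolding block_diagonal_mat_def by blast
    then have "perm_block_decomposition (Bs @ Cs) A" "\<forall>X\<in>set (Bs @ Cs). irreducible_mat X"
      using BC(3) unfolding perm_block_decomposition_def
      by (auto simp: diag_block_mat_append Let_def)
    then show ?thesis unfolding block_diagonal_mat_def by blast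
  qed
qed

lemma block_diagonal_mat_iff_card_cuts:
  assumes "permutation_mat A"
  shows "block_diagonal_mat N A \<longleftrightarrow> card (cuts A) = N"
  using ex_block_diagonal[OF assms] card_cuts_of_block_diagonal by metis

section \<open>Permutations\<close>

text \<open>A nonzero entry (r, c) records s (c + 1) = r + 1, and r < i means r + 1 \<le> i. The cut
  condition at i therefore says that s x and x lie in {1..i} together.\<close>

lemma cuts_mat_of_perm:
  assumes s: "s permutes {1..n}"
  shows "cuts (mat_of_perm n s) = {i \<in> {1..n}. s ` {1..i} = {1..i}}"
proof -
  have key: "(\<forall>r<n. \<forall>c<n. mat_of_perm n s $$ (r, c) \<noteq> 0 \<longrightarrow> (r < i \<longleftrightarrow> c < i)) \<longleftrightarrow>
      s ` {1..i} = {1..i}" (is "?L \<longleftrightarrow> ?R") if i: "i \<in> {1..n}" for i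
  proof
    assume L: ?L
    have "s ` {1..i} \<subseteq> {1..i}"
    proof (intro image_subsetI)
      fix x assume x: "x \<in> {1..i}"
      then have sx: "s x \<in> {1..n}" using i permutes_in_image[OF s, of x] by auto
      \<comment> \<open>Points x and s x are at least 1, so the truncated subtraction loses
        nothing.\<close>
      have "x - 1 < n" "s x - 1 < n" "s (x - 1 + 1) = s x - 1 + 1" using x i sx by auto
      then have "mat_of_perm n s $$ (s x - 1, x - 1) \<noteq> 0"
        unfolding mat_of_perm_def by simp
      then have "s x - 1 < i \<longleftrightarrow> x - 1 < i" using L \<open>x - 1 < n\<close> \<open>s x - 1 < n\<close> by blast
      then show "s x \<in> {1..i}" using x sx by auto
    qed
    \<comment> \<open>An injective map of a finite set into itself is onto, which upgrades the
      inclusion to equality.\<close>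
    moreover have "inj_on s {1..i}" using permutes_inj[OF s] inj_on_subset by blast
    ultimately show ?R by (simp add: endo_inj_surj)
  next
    assume R: ?R
    show ?L
    proof (intro allI impI)
      fix r c assume rc: "r < n" "c < n" "mat_of_perm n s $$ (r, c) \<noteq> 0"
      then have sc: "s (c + 1) = r + 1" by (simp add: mat_of_perm_def split: if_splits)
      have "s (c + 1) \<in> s ` {1..i} \<longleftrightarrow> c + 1 \<in> {1..i}"
        by (rule inj_image_mem_iff[OF permutes_inj[OF s]])
      then show "r < i \<longleftrightarrow> c < i" unfolding R sc by auto
    qed
  qed
  have dims: "dim_row (mat_of_perm n s) = n" "dim_col (mat_of_perm n s) = n"
    by (simp_all add: mat_of_perm_def)
  show ?thesis
    unfolding cuts_def dims by (rule Collect_cong, rule conj_cong[OF refl], rule key)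
qed

lemma block_diagonal_perms_iff:
  "s \<in> block_diagonal_perms n N \<longleftrightarrow>
     s permutes {1..n} \<and> card {i \<in> {1..n}. s ` {1..i} = {1..i}} = N"
proof (cases "s permutes {1..n}")
  case True
  then have "permutation_mat (mat_of_perm n s)"
    using bij_betw_mat_of_perm[of n] by (auto simp: bij_betw_def)
  then show ?thesis
    using True
    by (simp add: block_diagonal_perms_def block_diagonal_mat_iff_card_cuts cuts_mat_of_perm)
qed (simp add: block_diagonal_perms_def)

section \<open>From flags to the Cayley graph\<close>

lemma image_eq_iff_inv_comp_image:
  assumes "bij u"
  shows "u ` S = v ` S \<longleftrightarrow> (inv' u \<circ> v) ` S = S"
proof -
  \<comment> \<open>Applying the injective \<open>u\<close> to both sides keeps the equation
    equivalent and cancels the inverse, so comparing two flags amounts to a condition on one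
    permutation.\<close>
  have "(inv' u \<circ> v) ` S = S \<longleftrightarrow> u ` inv' u ` v ` S = u ` S"
    unfolding image_comp[symmetric] by (rule inj_image_eq_iff[OF bij_is_inj[OF assms], symmetric])
  also have "u ` inv' u ` v ` S = v ` S"
    by (rule image_f_inv_f[OF bij_is_surj[OF assms]])
  finally show ?thesis by (simp add: eq_commute)
qed

text \<open>A bijection and its inverse preserve the same sets, so they have the same cuts. This is
  the closure that \<open>connection_set\<close> demands.\<close>

lemma inv_in_block_diagonal_perms:
  assumes "s \<in> block_diagonal_perms n N"
  shows "inv' s \<in> block_diagonal_perms n N"
proof -
  have s: "s permutes {1..n}" using assms by (simp add: block_diagonal_perms_iff)
  have "inv' s ` S = S \<longleftrightarrow> s ` S = S" for S
    \<comment> \<open>With \<open>id\<close> in place of \<open>v\<close>, one side of the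
      equivalence concerns \<open>s\<close> and the other its inverse.\<close>
    using image_eq_iff_inv_comp_image[OF permutes_bij[OF s], of S id] by (simp add: eq_commute)
  then show ?thesis using assms permutes_inv[OF s] by (simp add: block_diagonal_perms_iff)
qed

text \<open>The flags differ in k positions iff they agree in the other n - k, and the positions of
  agreement are the cuts of the inverse of \<open>u\<close> followed by left composition, that is,
  of \<open>inv' u \<circ> v\<close>.\<close>

lemma full_flag_johnson_adjacent_iff:
  assumes u: "u permutes {1..n}" and v: "v permutes {1..n}" and k: "k \<le> n"
  shows "card {i \<in> {1..n}. u ` {1..i} \<noteq> v ` {1..i}} = k \<longleftrightarrow>
    inv' u \<circ> v \<in> block_diagonal_perms n (n - k)"
proof -
  let ?E = "{i \<in> {1..n}. u ` {1..i} = v ` {1..i}}"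
  have "{i \<in> {1..n}. u ` {1..i} \<noteq> v ` {1..i}} = {1..n} - ?E" by blast
  then have "card {i \<in> {1..n}. u ` {1..i} \<noteq> v ` {1..i}} = n - card ?E"
    using card_Diff_subset[of ?E "{1..n}"] by fastforce
  \<comment> \<open>Together with k \<le> n, this bound lets the truncated equation n - card ?E = k
    be solved for card ?E.\<close>
  moreover have "card ?E \<le> n" using card_mono[of "{1..n}" ?E] by fastforce
  moreover have "inv' u \<circ> v permutes {1..n}" by (rule permutes_compose[OF v permutes_inv[OF u]])
  ultimately show ?thesis
    using k by (auto simp: block_diagonal_perms_iff image_eq_iff_inv_comp_image[OF permutes_bij[OF u]])
qed

theorem theorem3p2:
  fixes n k :: nat
  assumes "0 < n" and "k < n"
  shows "connection_set (sym_group n) (block_diagonal_perms n (n - k)) \<and>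
         full_flag_johnson n k = cayley_graph (sym_group n) (block_diagonal_perms n (n - k))"
proof
  let ?T = "block_diagonal_perms n (n - k)"
  have T: "t permutes {1..n}" if "t \<in> ?T" for t
    using that by (simp add: block_diagonal_perms_iff)
  show "connection_set (sym_group n) ?T"
    unfolding connection_set_def
    using T inv_in_block_diagonal_perms by (auto simp: sym_group_carrier)
  \<comment> \<open>The only possible t is \<open>inv' u \<circ> v\<close>, by cancelling
    \<open>u\<close> on the left.\<close>
  have "(\<exists>t\<in>?T. v = u \<circ> t) \<longleftrightarrow> inv' u \<circ> v \<in> ?T" if u: "u permutes {1..n}" for u v
  proof
    assume "\<exists>t\<in>?T. v = u \<circ> t"
    then show "inv' u \<circ> v \<in> ?T"
      using permutes_inv_o(2)[OF u] by (auto simp: o_assoc)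
  next
    assume "inv' u \<circ> v \<in> ?T"
    moreover have "v = u \<circ> (inv' u \<circ> v)" using permutes_inv_o(1)[OF u] by (simp add: o_assoc)
    ultimately show "\<exists>t\<in>?T. v = u \<circ> t" by blast
  qed
  then have "card {i \<in> {1..n}. u ` {1..i} \<noteq> v ` {1..i}} = k \<longleftrightarrow> (\<exists>t\<in>?T. v = u \<circ> t)"
    if "u permutes {1..n}" "v permutes {1..n}" for u v
    using full_flag_johnson_adjacent_iff[OF that less_imp_le[OF assms(2)]] that(1) by blast
  \<comment> \<open>Both graphs have the permutations of {1..n} as vertices, so equality of the arc
    sets is what remains.\<close>
  then have "parcs (full_flag_johnson n k) = parcs (cayley_graph (sym_group n) ?T)"
    unfolding full_flag_johnson_def cayley_graph_def sym_group_carrier sym_group_mult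
      pair_pre_digraph.select_convs
    by blast
  then show "full_flag_johnson n k = cayley_graph (sym_group n) ?T"
    by (simp add: full_flag_johnson_def cayley_graph_def sym_group_def)
qed

end
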